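(* Let $u>0$ be arbitrarily given, and let $h(x)=\sum_{i=1}^n h_u(x_i)$ for every $x\in\mathbb{R}^n$. Then: (i) $0\le h(x)-\|x\|_p^p\le n u^q$ for every $x\in\mathbb{R}^n$. (ii) $h$ is $\sqrt{n}\,p\,u$-Lipschitz continuous in $\mathbb{R}^n$, i.e., $|h(x)-h(y)|\le\sqrt{n}\,p\,u\,\|x-y\|_2$ for all $x,y\in\mathbb{R}^n$. (iii) The Clarke subdifferential of $h$ exists at every $x\in\mathbb{R}^n$.
   Context: Let $p\in(0,1)$ and let $q$ be defined by $\frac1p+\frac1q=1$ (so $q<0$). Convention: $0^\beta=\infty$ for $\beta<0$. For $u>0$, define $h_u(t)=\min_{0\le s\le u}p\left(|t|s-\frac{s^q}{q}\right)$ for $t\in\mathbb{R}$. Also $\|x\|_p^p=\sum_{i=1}^n|x_i|^p$. The Clarke subdifferential of a function at $x$ is Clarke's generalized gradient, which is defined ("exists") when the function is Lipschitz continuous near $x$. *)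

theory Defs
  imports "HOL-Analysis.Analysis"
begin

text \<open>Power of a nonnegative real with the convention \<open>0\<^sup>\<beta> = \<infinity>\<close> for \<open>\<beta> < 0\<close>
  (whereas \<open>0 powr \<beta> = 0\<close> in the library).\<close>

definition epowr :: "real \<Rightarrow> real \<Rightarrow> ereal" where
  "epowr s \<beta> = (if s = 0 \<and> \<beta> < 0 then \<infinity> else ereal (s powr \<beta>))"

definition h_obj :: "real \<Rightarrow> real \<Rightarrow> real \<Rightarrow> real \<Rightarrow> ereal" where
  "h_obj p q t s = ereal p * (ereal (\<bar>t\<bar> * s) - epowr s q / ereal q)"

text \<open>\<open>LEAST\<close> is the least element of the set of values, i.e. an attained minimum.
  For \<open>q < 0\<close> and \<open>u > 0\<close> the objective is \<open>\<infinity>\<close> at \<open>s = 0\<close> and finite on \<open>(0, u]\<close>,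
  so the minimum is finite.\<close>

definition h_trunc :: "real \<Rightarrow> real \<Rightarrow> real \<Rightarrow> real \<Rightarrow> real" where
  "h_trunc p q u t = real_of_ereal (LEAST v. v \<in> h_obj p q t ` {0..u})"

definition h_sum :: "real \<Rightarrow> real \<Rightarrow> real \<Rightarrow> real ^ 'n \<Rightarrow> real" where
  "h_sum p q u x = (\<Sum>i\<in>UNIV. h_trunc p q u (x $ i))"

definition lp_pow :: "real \<Rightarrow> real ^ 'n \<Rightarrow> real" where
  "lp_pow p x = (\<Sum>i\<in>UNIV. \<bar>x $ i\<bar> powr p)"

definition lipschitz_near :: "('a::metric_space \<Rightarrow> 'b::metric_space) \<Rightarrow> 'a \<Rightarrow> bool" where
  "lipschitz_near f x \<longleftrightarrow> (\<exists>\<epsilon>>0. \<exists>L. L-lipschitz_on (ball x \<epsilon>) f)"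

text \<open>Clarke's generalized directional derivative: the upper limit of
  \<open>(f (y + t v) - f y) / t\<close> as \<open>y \<rightarrow> x\<close> (with \<open>y = x\<close> allowed) and \<open>t \<down> 0\<close>.\<close>

definition clarke_dderiv :: "('a::real_normed_vector \<Rightarrow> real) \<Rightarrow> 'a \<Rightarrow> 'a \<Rightarrow> ereal" where
  "clarke_dderiv f x v =
     Limsup (nhds x \<times>\<^sub>F at_right 0) (\<lambda>(y, t). ereal ((f (y + t *\<^sub>R v) - f y) / t))"

text \<open>The generalized gradient is defined only for functions that are Lipschitz near the
  point, hence the relational form. Dual vectors are identified with vectors through the
  inner product.\<close>

definition has_clarke_subdifferential ::
    "('a::euclidean_space \<Rightarrow> real) \<Rightarrow> 'a set \<Rightarrow> 'a \<Rightarrow> bool" where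
  "has_clarke_subdifferential f G x \<longleftrightarrow>
     lipschitz_near f x \<and> G = {\<xi>. \<forall>v. ereal (\<xi> \<bullet> v) \<le> clarke_dderiv f x v}"

end

theory Submission
  imports Defs
begin

text \<open>The objective \<open>s \<mapsto> p (\<bar>t\<bar> s - s\<^sup>q / q)\<close> is convex on the positive reals, and its unconstrained
  minimizer for \<open>t \<noteq> 0\<close> is \<open>\<bar>t\<bar>\<^sup>p\<^sup>-\<^sup>1\<close> with value \<open>\<bar>t\<bar>\<^sup>p\<close>. Hence the minimizer over \<open>[0, u]\<close> is
  \<open>s(t) = min u \<bar>t\<bar>\<^sup>p\<^sup>-\<^sup>1\<close>, and comparing with the unconstrained minimum gives (i). Inserting
  \<open>s(b)\<close> as a competitor at \<open>a\<close> yields the one-sided estimate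
  \<open>h\<^sub>u(a) - h\<^sub>u(b) \<le> p (\<bar>a\<bar> - \<bar>b\<bar>) s(b)\<close>. With \<open>s \<le> u\<close> and the Cauchy-Schwarz inequality it gives (ii).
  With \<open>b = a + \<tau> v\<close> and \<open>\<tau> \<down> 0\<close> it bounds difference quotients from below, so that the vector
  with coordinates \<open>p s(x\<^sub>i) sgn x\<^sub>i\<close> is a Clarke subgradient at \<open>x\<close>; thus no separation theorem
  is needed for (iii).\<close>

section \<open>Preliminaries: tangent inequality, Clarke derivatives, the candidate
  minimizer\<close>

lemma powr_ge_tangent:
  fixes q r s :: real
  assumes "q \<le> 0" "0 < r" "0 < s"
  shows "r powr q + q * r powr (q - 1) * (s - r) \<le> s powr q"
proof -
  \<comment> \<open>Scaling by \<open>r powr q\<close> reduces the claim to 1 + q (x - 1) \<le> x^q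
    at x = s / r; the logarithm separates the two sides, and q \<le> 0 reverses ln x \<le> x -
    1.\<close>
  have "q * (s / r - 1) \<le> q * ln (s / r)"
    using assms ln_le_minus_one[of "s / r"] by (intro mult_left_mono_neg) auto
  also have "1 + q * ln (s / r) \<le> (s / r) powr q"
    using assms exp_ge_add_one_self[of "q * ln (s / r)"] by (simp add: powr_def)
  finally have "r powr q * (1 + q * (s / r - 1)) \<le> r powr q * (s / r) powr q"
    by (intro mult_left_mono) auto
  also have "\<dots> = s powr q"
    using assms by (simp add: powr_divide)
  finally show ?thesis
    using assms by (simp add: powr_diff field_simps)
qed

text \<open>The joint limsup dominates the one along y = x, because \<open>nhds x\<close> keeps the
  point x itself. A minorant with a limit is enough, so no directional derivative has to
  exist.\<close>

lemma clarke_dderiv_geI: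
  fixes f :: "'a::real_normed_vector \<Rightarrow> real"
  assumes "(g \<longlongrightarrow> c) (at_right 0)"
    and "\<forall>\<^sub>F t in at_right 0. g t \<le> (f (x + t *\<^sub>R v) - f x) / t"
  shows "ereal c \<le> clarke_dderiv f x v"
proof -
  let ?Q = "\<lambda>(y, t). ereal ((f (y + t *\<^sub>R v) - f y) / t)"
  have "ereal c = Limsup (at_right 0) (\<lambda>t. ereal (g t))"
    using assms(1) by (intro lim_imp_Limsup[symmetric]) auto
  also have "\<dots> \<le> Limsup (at_right 0) (\<lambda>t. ?Q (x, t))"
    using assms(2) by (intro Limsup_mono) auto
  also have "\<dots> \<le> Limsup (filtermap (Pair x) (at_right 0)) ?Q"
    by (rule Limsup_filtermap_ge)
  also have "\<dots> \<le> Limsup (nhds x \<times>\<^sub>F at_right 0) ?Q"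
  proof -
    have "filterlim (Pair x) (nhds x \<times>\<^sub>F at_right 0) (at_right (0::real))"
      by (intro filterlim_Pair tendsto_const filterlim_ident)
    then have "filtermap (Pair x) (at_right 0) \<le> nhds x \<times>\<^sub>F at_right (0::real)"
      by (simp add: filterlim_def)
    then show ?thesis
      unfolding Limsup_def by (intro INF_superset_mono) (auto dest: filter_leD)
  qed
  finally show ?thesis
    by (simp add: clarke_dderiv_def)
qed

lemma sum_abs_le_sqrt_card_norm:
  fixes z :: "real ^ 'n"
  shows "(\<Sum>i\<in>UNIV. \<bar>z $ i\<bar>) \<le> sqrt (real CARD('n)) * norm z"
  using L2_set_mult_ineq[where A = "UNIV :: 'n set" and f = "\<lambda>_. 1" and g = "\<lambda>i. z $ i"]
  by (simp add: norm_vec_def L2_set_def)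

text \<open>The case t = 0 is separate because \<open>0 powr (p - 1)\<close> is 0, whereas the
  convention makes this power \<infinity>, so that the minimum with u is u.\<close>

definition trunc_minimizer :: "real \<Rightarrow> real \<Rightarrow> real \<Rightarrow> real" where
  "trunc_minimizer p u t = (if t = 0 then u else min u (\<bar>t\<bar> powr (p - 1)))"

lemma trunc_minimizer_pos: "0 < u \<Longrightarrow> 0 < trunc_minimizer p u t"
  by (simp add: trunc_minimizer_def)

lemma trunc_minimizer_le: "trunc_minimizer p u t \<le> u"
  by (simp add: trunc_minimizer_def)

lemma isCont_trunc_minimizer:
  assumes "t \<noteq> 0"
  shows "isCont (trunc_minimizer p u) t"
proof -
  have "isCont (\<lambda>t. min u (\<bar>t\<bar> powr (p - 1))) t"
    using assms by (intro continuous_intros) auto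
  moreover have "\<forall>\<^sub>F t in nhds t. trunc_minimizer p u t = min u (\<bar>t\<bar> powr (p - 1))"
    using t1_space_nhds[OF assms] by eventually_elim (simp add: trunc_minimizer_def)
  ultimately show ?thesis
    by (simp add: isCont_cong)
qed

section \<open>The scalar minimization problem\<close>

locale conjugate_exponents =
  fixes p q :: real
  assumes p_pos: "0 < p" and p_less_1: "p < 1" and conj: "1 / p + 1 / q = 1"
begin

text \<open>Real-valued form of \<open>h_obj\<close>, faithful only for s > 0: at s = 0 it takes the
  spurious value 0 instead of \<infinity>.\<close>

definition obj :: "real \<Rightarrow> real \<Rightarrow> real" where
  "obj t s = p * (\<bar>t\<bar> * s - s powr q / q)"

lemma q_eq: "q = p / (p - 1)"
proof -
  have "q \<noteq> 0"
    using conj p_pos p_less_1 by (auto simp: field_simps)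
  then show ?thesis
    using conj p_pos p_less_1 by (simp add: field_simps)
qed

lemma q_neg: "q < 0"
  using p_pos p_less_1 by (simp add: q_eq divide_pos_neg)

lemma exponent_simps: "(p - 1) * q = p" "(p - 1) * (q - 1) = 1" "p / q = p - 1"
  using p_pos p_less_1 by (simp_all add: q_eq field_simps)

lemma h_obj_eq:
  assumes "0 \<le> s"
  shows "h_obj p q t s = (if s = 0 then \<infinity> else ereal (obj t s))"
  using assms q_neg p_pos by (simp add: h_obj_def epowr_def obj_def ereal_divide_eq)

text \<open>The factor p (|t| - r^(q-1)) is the derivative of the objective at r, so this is its
  convexity inequality; dividing the tangent bound for s^q by q < 0 turns it around.\<close>

lemma obj_diff_ge:
  assumes "0 < r" "0 < s"
  shows "p * (\<bar>t\<bar> - r powr (q - 1)) * (s - r) \<le> obj t s - obj t r"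
proof -
  have "(s powr q - r powr q) / q \<le> (q * r powr (q - 1) * (s - r)) / q"
    using powr_ge_tangent[of q r s] assms q_neg by (intro divide_right_mono_neg) auto
  then have "(s powr q - r powr q) / q \<le> r powr (q - 1) * (s - r)"
    using q_neg by simp
  then have "p * ((\<bar>t\<bar> - r powr (q - 1)) * (s - r))
      \<le> p * (\<bar>t\<bar> * (s - r) - (s powr q - r powr q) / q)"
    using p_pos by (intro mult_left_mono) (auto simp: algebra_simps)
  then show ?thesis
    by (simp add: obj_def algebra_simps diff_divide_distrib)
qed

lemma obj_unconstrained_min:
  assumes "t \<noteq> 0"
  shows "obj t (\<bar>t\<bar> powr (p - 1)) = \<bar>t\<bar> powr p"
proof -
  have "\<bar>t\<bar> * \<bar>t\<bar> powr (p - 1) = \<bar>t\<bar> powr p"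
    using assms by (simp add: powr_diff)
  then have "obj t (\<bar>t\<bar> powr (p - 1)) = p * \<bar>t\<bar> powr p - (p - 1) * \<bar>t\<bar> powr p"
    unfolding exponent_simps(3)[symmetric]
    by (simp add: obj_def powr_powr exponent_simps(1) right_diff_distrib)
  then show ?thesis
    by (simp add: left_diff_distrib)
qed

lemma powr_le_obj:
  assumes "0 < s"
  shows "\<bar>t\<bar> powr p \<le> obj t s"
proof (cases "t = 0")
  case True
  then show ?thesis
    using q_neg p_pos by (simp add: obj_def mult_nonneg_nonpos divide_nonneg_neg)
next
  case False
  \<comment> \<open>The slope of the objective thus vanishes at |t|^(p-1).\<close>
  then have "(\<bar>t\<bar> powr (p - 1)) powr (q - 1) = \<bar>t\<bar>"
    by (simp add: powr_powr exponent_simps)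
  then show ?thesis
    using obj_diff_ge[of "\<bar>t\<bar> powr (p - 1)" s t] False assms by (simp add: obj_unconstrained_min)
qed

text \<open>When the constraint s \<le> u is active, the objective has nonpositive slope at u.
  Raising u \<le> |t|^(p-1) to the negative power q - 1 reverses it.\<close>

lemma abs_le_powr_of_bound_active:
  assumes "0 < u" "trunc_minimizer p u t = u"
  shows "\<bar>t\<bar> \<le> u powr (q - 1)"
proof (cases "t = 0")
  case False
  with assms have "u \<le> \<bar>t\<bar> powr (p - 1)"
    by (simp add: trunc_minimizer_def)
  then have "(\<bar>t\<bar> powr (p - 1)) powr (q - 1) \<le> u powr (q - 1)"
    using assms q_neg by (intro powr_mono2') auto
  then show ?thesis
    using False by (simp add: powr_powr exponent_simps)
qed simp

lemma trunc_minimizer_cases: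
  obtains "trunc_minimizer p u t = u"
    | "t \<noteq> 0" "trunc_minimizer p u t = \<bar>t\<bar> powr (p - 1)"
  by (cases "t = 0 \<or> u \<le> \<bar>t\<bar> powr (p - 1)") (auto simp: trunc_minimizer_def)

lemma obj_trunc_minimizer_le:
  assumes "0 < s" "s \<le> u"
  shows "obj t (trunc_minimizer p u t) \<le> obj t s"
proof (rule trunc_minimizer_cases[of u t])
  assume eq: "trunc_minimizer p u t = u"
  have "0 \<le> p * (\<bar>t\<bar> - u powr (q - 1)) * (s - u)"
    using abs_le_powr_of_bound_active[OF _ eq] assms p_pos
    by (intro mult_nonpos_nonpos mult_nonneg_nonpos) auto
  then show ?thesis
    using obj_diff_ge[of u s t] assms eq by simp
next
  assume "t \<noteq> 0" "trunc_minimizer p u t = \<bar>t\<bar> powr (p - 1)"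
  then show ?thesis
    using powr_le_obj[OF assms(1)] by (simp add: obj_unconstrained_min)
qed

section \<open>Value, bounds and Lipschitz constant in one variable\<close>

lemma h_trunc_eq:
  assumes "0 < u"
  shows "h_trunc p q u t = obj t (trunc_minimizer p u t)"
proof -
  let ?s = "trunc_minimizer p u t"
  have s: "0 < ?s" "?s \<le> u"
    using assms by (auto intro: trunc_minimizer_pos trunc_minimizer_le)
  have "(LEAST v. v \<in> h_obj p q t ` {0..u}) = ereal (obj t ?s)"
  proof (rule Least_equality)
    show "ereal (obj t ?s) \<in> h_obj p q t ` {0..u}"
      using s by (intro image_eqI[of _ _ ?s]) (auto simp: h_obj_eq)
    show "ereal (obj t ?s) \<le> v" if "v \<in> h_obj p q t ` {0..u}" for v
      using that by (auto simp: h_obj_eq intro!: obj_trunc_minimizer_le)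
  qed
  then show ?thesis
    by (simp add: h_trunc_def)
qed

lemma h_trunc_ge:
  assumes "0 < u"
  shows "\<bar>t\<bar> powr p \<le> h_trunc p q u t"
  using assms by (simp add: h_trunc_eq powr_le_obj trunc_minimizer_pos)

lemma h_trunc_le:
  assumes "0 < u"
  shows "h_trunc p q u t \<le> \<bar>t\<bar> powr p + u powr q"
proof (rule trunc_minimizer_cases[of u t])
  assume eq: "trunc_minimizer p u t = u"
  have "p * (\<bar>t\<bar> * u) \<le> p * (u powr (q - 1) * u)"
    using abs_le_powr_of_bound_active[OF assms eq] assms p_pos
    by (intro mult_left_mono mult_right_mono) auto
  then have "p * (\<bar>t\<bar> * u) \<le> p * u powr q"
    using assms by (simp add: powr_diff)
  \<comment> \<open>The coefficients p and 1 - p = -p/q of u^q add up to 1.\<close>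
  moreover have "obj t u = p * (\<bar>t\<bar> * u) - (p - 1) * u powr q"
    unfolding exponent_simps(3)[symmetric] by (simp add: obj_def right_diff_distrib)
  ultimately have "obj t u \<le> u powr q"
    by (simp add: left_diff_distrib)
  then show ?thesis
    using assms eq by (simp add: h_trunc_eq add_increasing)
next
  assume "t \<noteq> 0" "trunc_minimizer p u t = \<bar>t\<bar> powr (p - 1)"
  then show ?thesis
    using assms by (simp add: h_trunc_eq obj_unconstrained_min)
qed

text \<open>As a minimum of functions affine in |t|, the truncation is concave in |t|, and p s(b) is
  the slope of the affine function active at b.\<close>

lemma h_trunc_diff_le:
  assumes "0 < u"
  shows "h_trunc p q u a - h_trunc p q u b \<le> p * trunc_minimizer p u b * (\<bar>a\<bar> - \<bar>b\<bar>)"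
proof -
  have "obj a (trunc_minimizer p u a) \<le> obj a (trunc_minimizer p u b)"
    using assms by (intro obj_trunc_minimizer_le trunc_minimizer_pos trunc_minimizer_le)
  then show ?thesis
    using assms by (simp add: h_trunc_eq obj_def algebra_simps)
qed

lemma h_trunc_lipschitz:
  assumes "0 < u"
  shows "\<bar>h_trunc p q u a - h_trunc p q u b\<bar> \<le> p * u * \<bar>a - b\<bar>"
proof -
  have "h_trunc p q u a - h_trunc p q u b \<le> p * u * \<bar>a - b\<bar>" for a b
  proof -
    note h_trunc_diff_le[OF assms, of a b]
    also have "p * trunc_minimizer p u b * (\<bar>a\<bar> - \<bar>b\<bar>) \<le> p * trunc_minimizer p u b * \<bar>a - b\<bar>"
      using p_pos trunc_minimizer_pos[OF assms, of p b] by (intro mult_left_mono) auto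
    also have "\<dots> \<le> p * u * \<bar>a - b\<bar>"
      using p_pos by (intro mult_left_mono mult_right_mono trunc_minimizer_le) auto
    finally show ?thesis .
  qed
  from this[of a b] this[of b a] show ?thesis
    by (simp add: abs_minus_commute abs_le_iff)
qed

section \<open>Passage to n coordinates: bounds, Lipschitz constant, Clarke subgradients\<close>

lemma h_sum_lp_pow_bounds:
  fixes x :: "real ^ 'n"
  assumes "0 < u"
  shows "0 \<le> h_sum p q u x - lp_pow p x"
    and "h_sum p q u x - lp_pow p x \<le> real CARD('n) * u powr q"
proof -
  show "0 \<le> h_sum p q u x - lp_pow p x"
    using assms by (simp add: h_sum_def lp_pow_def sum_mono h_trunc_ge)
  have "h_sum p q u x \<le> (\<Sum>i\<in>UNIV. \<bar>x $ i\<bar> powr p + u powr q)"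
    unfolding h_sum_def using assms by (intro sum_mono h_trunc_le)
  then show "h_sum p q u x - lp_pow p x \<le> real CARD('n) * u powr q"
    by (simp add: lp_pow_def sum.distrib)
qed

lemma h_sum_lipschitz:
  assumes "0 < u"
  shows "(sqrt (real CARD('n)) * p * u)-lipschitz_on UNIV (h_sum p q u :: real ^ 'n \<Rightarrow> real)"
proof (rule lipschitz_onI)
  fix x y :: "real ^ 'n"
  have "\<bar>h_sum p q u x - h_sum p q u y\<bar> \<le> (\<Sum>i\<in>UNIV. p * u * \<bar>(x - y) $ i\<bar>)"
    unfolding h_sum_def sum_subtractf[symmetric]
    using h_trunc_lipschitz[OF assms] by (intro order_trans[OF sum_abs] sum_mono) simp
  also have "\<dots> = p * u * (\<Sum>i\<in>UNIV. \<bar>(x - y) $ i\<bar>)"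
    by (simp add: sum_distrib_left)
  also have "\<dots> \<le> p * u * (sqrt (real CARD('n)) * norm (x - y))"
    using assms p_pos by (intro mult_left_mono sum_abs_le_sqrt_card_norm) auto
  finally show "dist (h_sum p q u x) (h_sum p q u y) \<le> sqrt (real CARD('n)) * p * u * dist x y"
    by (simp add: dist_real_def dist_norm mult_ac)
qed (use assms p_pos in auto)

lemma h_trunc_quotient_minorant:
  assumes "0 < u"
  shows "\<exists>g. (g \<longlongrightarrow> p * trunc_minimizer p u a * sgn a * v) (at_right 0) \<and>
    (\<forall>\<^sub>F t in at_right 0. g t \<le> (h_trunc p q u (a + t * v) - h_trunc p q u a) / t)"
proof (cases "a = 0")
  case True
  \<comment> \<open>The origin is a global minimizer, so the quotients there are nonnegative and the
    zero minorant matches \<open>sgn 0 = 0\<close>.\<close>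
  have min: "h_trunc p q u 0 \<le> h_trunc p q u b" for b
    using h_trunc_diff_le[OF assms, of 0 b] p_pos trunc_minimizer_pos[OF assms, of p b]
    by (smt (verit) mult_nonneg_nonpos mult_nonneg_nonneg abs_ge_zero abs_zero)
  have "\<forall>\<^sub>F t in at_right 0. 0 \<le> (h_trunc p q u (a + t * v) - h_trunc p q u a) / t"
    using eventually_at_right_less[of "0::real"] by eventually_elim (simp add: True min)
  then show ?thesis
    using True by (intro exI[of _ "\<lambda>_. 0"]) simp
next
  case False
  \<comment> \<open>The minimizer is taken at the moving point: the slope at a itself would only
    bound the quotient from above. Continuity at a \<noteq> 0 supplies the limit.\<close>
  let ?g = "\<lambda>t. p * trunc_minimizer p u (a + t * v) * sgn a * v"
  have lim: "((\<lambda>t. a + t * v) \<longlongrightarrow> a) (at_right 0)"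
    by (auto intro!: tendsto_eq_intros)
  have "(?g \<longlongrightarrow> p * trunc_minimizer p u a * sgn a * v) (at_right 0)"
    using isCont_tendsto_compose[OF isCont_trunc_minimizer[OF False] lim]
    by (intro tendsto_intros)
  \<comment> \<open>For small t the sign of a is kept, which makes |a + t v| - |a| linear in
    t.\<close>
  moreover have "\<forall>\<^sub>F t in at_right 0. 0 < (a + t * v) * sgn a"
  proof (rule order_tendstoD(1))
    show "((\<lambda>t. (a + t * v) * sgn a) \<longlongrightarrow> a * sgn a) (at_right 0)"
      by (intro tendsto_mult lim tendsto_const)
    show "0 < a * sgn a"
      using False by (simp add: sgn_if)
  qed
  then have "\<forall>\<^sub>F t in at_right 0. ?g t \<le> (h_trunc p q u (a + t * v) - h_trunc p q u a) / t"
    using eventually_at_right_less[of "0::real"]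
  proof eventually_elim
    case (elim t)
    then have "\<bar>a + t * v\<bar> - \<bar>a\<bar> = sgn a * v * t"
      by (auto simp: sgn_if split: if_splits)
    then show ?case
      using h_trunc_diff_le[OF assms, of a "a + t * v"] elim
      by (simp add: pos_le_divide_eq algebra_simps)
  qed
  ultimately show ?thesis
    by (intro exI[of _ ?g] conjI)
qed

text \<open>Lower bounds on limsups do not add over coordinates. Minorants with genuine limits do,
  which is why the scalar lemma provides them.\<close>

lemma h_sum_clarke_subgradient:
  fixes x v :: "real ^ 'n"
  assumes "0 < u"
  shows "ereal ((\<chi> i. p * trunc_minimizer p u (x $ i) * sgn (x $ i)) \<bullet> v)
    \<le> clarke_dderiv (h_sum p q u) x v"
proof -
  let ?minorant = "\<lambda>i g.
    (g \<longlongrightarrow> p * trunc_minimizer p u (x $ i) * sgn (x $ i) * v $ i) (at_right 0) \<and>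
    (\<forall>\<^sub>F t in at_right 0. g t \<le> (h_trunc p q u (x $ i + t * v $ i) - h_trunc p q u (x $ i)) / t)"
  have "\<forall>i. \<exists>g. ?minorant i g"
    by (intro allI h_trunc_quotient_minorant[OF assms])
  then obtain g where g: "\<forall>i. ?minorant i (g i)"
    unfolding choice_iff ..
  show ?thesis
  proof (rule clarke_dderiv_geI)
    show "((\<lambda>t. \<Sum>i\<in>UNIV. g i t)
        \<longlongrightarrow> (\<chi> i. p * trunc_minimizer p u (x $ i) * sgn (x $ i)) \<bullet> v) (at_right 0)"
      unfolding inner_vec_def using g by (intro tendsto_sum) simp
    have "\<forall>\<^sub>F t in at_right 0. \<forall>i.
        g i t \<le> (h_trunc p q u (x $ i + t * v $ i) - h_trunc p q u (x $ i)) / t"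
      using g by (intro eventually_all_finite) blast
    then show "\<forall>\<^sub>F t in at_right 0.
        (\<Sum>i\<in>UNIV. g i t) \<le> (h_sum p q u (x + t *\<^sub>R v) - h_sum p q u x) / t"
      by eventually_elim
        (simp add: h_sum_def sum_subtractf[symmetric] sum_divide_distrib sum_mono)
  qed
qed

end

theorem corollary2p5:
  fixes p q u :: real
    and h :: "real ^ 'n \<Rightarrow> real"
  assumes "0 < p" and "p < 1"
    and "1 / p + 1 / q = 1"
    and "u > 0"
    and "\<And>x. h x = h_sum p q u x"
  shows "(\<forall>x. 0 \<le> h x - lp_pow p x \<and> h x - lp_pow p x \<le> real CARD('n) * u powr q)
    \<and> (sqrt (real CARD('n)) * p * u)-lipschitz_on UNIV h
    \<and> (\<forall>x. \<exists>G. has_clarke_subdifferential h G x \<and> G \<noteq> {})"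
proof -
  interpret conjugate_exponents p q
    using assms by unfold_locales
  have h: "h = h_sum p q u"
    using assms(5) by (rule ext)
  have lip: "(sqrt (real CARD('n)) * p * u)-lipschitz_on UNIV h"
    unfolding h by (rule h_sum_lipschitz[OF \<open>u > 0\<close>])
  have "lipschitz_near h x" for x
    unfolding lipschitz_near_def using lipschitz_on_subset[OF lip subset_UNIV] zero_less_one by blast
  moreover have "{\<xi>. \<forall>v. ereal (\<xi> \<bullet> v) \<le> clarke_dderiv h x v} \<noteq> {}" for x
    unfolding h using h_sum_clarke_subgradient[OF \<open>u > 0\<close>] by blast
  ultimately have "\<exists>G. has_clarke_subdifferential h G x \<and> G \<noteq> {}" for x
    unfolding has_clarke_subdifferential_def by blast
  then show ?thesis
    using lip h_sum_lp_pow_bounds[OF \<open>u > 0\<close>, where ?'n = 'n] unfolding h by blast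
qed

end
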